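(* Let $\alpha,\beta,\sigma>0$, $\mu\in\mathbb{R}$, and let $X$ be a random variable with the beta normal distribution $\mathrm{BN}(\alpha,\beta,\mu,\sigma)$, with density $f$. Then the Shannon entropy $\mathrm{H}(X)=-\int_{-\infty}^{\infty}f(x)\ln f(x)\,\mathrm{d}x$ is given by $$\mathrm{H}(X)=\ln\left\{\sqrt{2\pi}\,\sigma\,\mathrm{B}(\alpha,\beta)\right\}+\frac{1}{2\sigma^2}\left[\mathrm{E}(X^2)-2\mu\,\mathrm{E}(X)+\mu^2\right]+\frac{1}{\mathrm{B}(\alpha,\beta)}\sum_{n=1}^{\infty}\frac1n\left[(\alpha-1)\,\mathrm{B}(\alpha,n+\beta)+(\beta-1)\,\mathrm{B}(n+\alpha,\beta)\right].$$
   Context: $\Phi$ and $\phi$ denote the standard normal cumulative distribution function and density, and $\mathrm{B}(\cdot,\cdot)$ is the beta function. The beta normal distribution $\mathrm{BN}(\alpha,\beta,\mu,\sigma)$ has density $$f(x)=\frac{1}{\sigma\,\mathrm{B}(\alpha,\beta)}\left[\Phi\left(\frac{x-\mu}{\sigma}\right)\right]^{\alpha-1}\left[1-\Phi\left(\frac{x-\mu}{\sigma}\right)\right]^{\beta-1}\phi\left(\frac{x-\mu}{\sigma}\right),\qquad x\in\mathbb{R}.$$ *)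

theory Defs
  imports "HOL-Probability.Probability"
begin

definition beta_normal_density :: "real \<Rightarrow> real \<Rightarrow> real \<Rightarrow> real \<Rightarrow> real \<Rightarrow> real" where
  "beta_normal_density \<alpha> \<beta> \<mu> \<sigma> x =
     1 / (\<sigma> * Beta \<alpha> \<beta>)
       * (cdf std_normal_distribution ((x - \<mu>) / \<sigma>)) powr (\<alpha> - 1)
       * (1 - cdf std_normal_distribution ((x - \<mu>) / \<sigma>)) powr (\<beta> - 1)
       * std_normal_density ((x - \<mu>) / \<sigma>)"

text \<open>The Bochner integral is 0 for a non-integrable integrand, so this is meaningful only
  together with integrability of the integrand.\<close>

definition shannon_entropy :: "(real \<Rightarrow> real) \<Rightarrow> real" where
  "shannon_entropy f = - (LINT x|lborel. f x * ln (f x))"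

end

theory Submission
  imports Defs
begin

text \<open>
  Write \<open>z = (x - \<mu>) / \<sigma>\<close> and let \<open>\<Phi>\<close> be the standard normal distribution function. The logarithm
  of the density is a constant plus \<open>(\<alpha> - 1) * ln (\<Phi> z) + (\<beta> - 1) * ln (1 - \<Phi> z) - z\<^sup>2 / 2\<close>
  (\<open>ln_beta_normal_density\<close>), so the entropy reduces to the expectations of these three
  random variables. The quadratic one gives the moments of \<open>X\<close>.

  The two logarithms are functions of \<open>\<Phi> z\<close> alone. Since \<open>\<Phi>\<close> is continuous, it transforms the
  standard normal law into the uniform law on \<open>{0..1}\<close> (\<open>distr_cdf_uniform\<close>), so under the beta
  normal law \<open>\<Phi> z\<close> has the beta density, and the expectation of \<open>- ln (\<Phi> z)\<close> becomes the integral
  of \<open>- ln u\<close> against a beta density. Expanding \<open>- ln u\<close> in powers of \<open>1 - u\<close> and integrating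
  termwise produces the series of beta values (\<open>beta_weight_ln_sums\<close>); the substitution of
  \<open>1 - u\<close> for \<open>u\<close> treats \<open>ln (1 - \<Phi> z)\<close>.

  Integrability of \<open>z\<^sup>2\<close> comes from the same source: the Gaussian tail bound
  \<open>\<Phi> z \<le> exp (- z\<^sup>2 / 2)\<close> for \<open>z \<le> 0\<close> and its mirror image say that \<open>z\<^sup>2\<close> is at most
  \<open>- 2 * ln (\<Phi> z) - 2 * ln (1 - \<Phi> z)\<close> (\<open>square_le_ln_std_normal_cdf\<close>), whose expectation is
  already known to be finite.
\<close>

section \<open>The probability integral transform\<close>

text \<open>For \<open>0 \<le> y < 1\<close> the sublevel set of the distribution function is, by continuity and
  monotonicity, either empty or a half-line \<open>{..q}\<close>, and in the second case the
  distribution function takes exactly the value \<open>y\<close> at \<open>q\<close>.\<close>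

lemma (in real_distribution) distr_cdf_uniform:
  assumes no_atom: "\<And>x. isCont (cdf M) x"
  shows "distr M borel (cdf M) = uniform_measure lborel {0..1}"
proof -
  have mono: "cdf M x \<le> cdf M y" if "x \<le> y" for x y
    using that by (rule cdf_nondecreasing)
  have [measurable]: "cdf M \<in> borel_measurable borel"
    using mono by (intro borel_measurable_mono) (auto simp: mono_def)
  interpret D: real_distribution "distr M borel (cdf M)"
    by simp
  interpret U: prob_space "uniform_measure lborel {0..1::real}"
    by (rule prob_space_uniform_measure) auto
  interpret U: real_distribution "uniform_measure lborel {0..1::real}"
    by standard auto
  have D: "cdf (distr M borel (cdf M)) y = measure M {x. cdf M x \<le> y}" for y
    by (simp add: cdf_def2 measure_distr vimage_def)
  have U: "cdf (uniform_measure lborel {0..1}) y = measure lborel ({0..1} \<inter> {..y})" for y :: real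
    by (simp add: cdf_def2)
  have sub: "measure M {x. cdf M x \<le> y} = y" if y: "0 \<le> y" "y < 1" for y
  proof -
    let ?S = "{x. cdf M x \<le> y}"
    from cdf_lim_at_top_prob y(2) have "\<forall>\<^sub>F x in at_top. y < cdf M x"
      by (rule order_tendstoD)
    then obtain b where b: "y < cdf M b"
      by (auto simp: eventually_at_top_linorder)
    show ?thesis
    proof (cases "?S = {}")
      case True
      have "\<not> 0 < y"
      proof
        assume "0 < y"
        with cdf_lim_at_bot have "\<forall>\<^sub>F x in at_bot. cdf M x < y"
          by (rule order_tendstoD)
        then obtain x where "cdf M x < y"
          by (auto simp: eventually_at_bot_linorder)
        with True show False
          using less_imp_le by blast
      qed
      with True y show ?thesis by simp
    next
      case False
      have le_b: "x \<le> b" if "x \<in> ?S" for x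
        using that b mono[of b x] by (cases "x \<le> b") auto
      have closed: "closed ?S"
        using no_atom by (intro closed_Collect_le continuous_at_imp_continuous_on) auto
      define q where "q = Sup ?S"
      have bdd: "bdd_above ?S"
        using le_b by (auto simp: bdd_above_def)
      have q: "q \<in> ?S"
        unfolding q_def using False bdd closed by (intro closed_contains_Sup)
      have upper: "x \<le> q" if "x \<in> ?S" for x
        unfolding q_def using that bdd by (rule cSup_upper)
      have S: "?S = {..q}"
        using q upper mono by (force intro: order_trans)
      have "\<exists>x\<ge>q. x \<le> b \<and> cdf M x = y"
        using q b le_b[OF q] no_atom by (intro IVT) auto
      then have "y \<le> cdf M q"
        using upper mono by force
      with q S show ?thesis
        by (simp add: cdf_def2)
    qed
  qed
  have "cdf (distr M borel (cdf M)) y = cdf (uniform_measure lborel {0..1}) y" for y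
  proof -
    consider "y < 0" | "0 \<le> y" "y < 1" | "1 \<le> y" by linarith
    then show ?thesis
    proof cases
      case 1
      have "{x. cdf M x \<le> y} = {}" "{0..1} \<inter> {..y} = {}"
        using 1 cdf_nonneg by (auto simp: not_le intro: less_le_trans)
      then show ?thesis by (simp add: D U)
    next
      case 2
      then have "{0..1} \<inter> {..y} = {0..y}" by auto
      with 2 show ?thesis by (simp add: D U sub)
    next
      case 3
      then have "{x. cdf M x \<le> y} = UNIV" "{0..1} \<inter> {..y} = {0..1}"
        using cdf_bounded_prob by (auto intro: order_trans)
      with prob_space show ?thesis by (simp add: D U)
    qed
  qed
  then show ?thesis
    by (intro cdf_unique) (auto simp: fun_eq_iff, unfold_locales)
qed

section \<open>The standard normal distribution function\<close>

interpretation std_normal: real_distribution std_normal_distribution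
  by (rule real_dist_normal_dist)

lemma isCont_std_normal_cdf: "isCont (cdf std_normal_distribution) x"
proof -
  have "emeasure std_normal_distribution {x} = 0"
    by (subst emeasure_density) (auto intro!: nn_integral_null_set simp: mult.commute)
  then show ?thesis
    by (simp add: std_normal.isCont_cdf measure_def)
qed

lemma borel_measurable_std_normal_cdf [measurable]:
  "cdf std_normal_distribution \<in> borel_measurable borel"
  by (intro borel_measurable_mono) (auto simp: mono_def std_normal.cdf_nondecreasing)

lemma std_normal_cdf_pos: "0 < cdf std_normal_distribution z"
proof -
  have "emeasure std_normal_distribution {..z} \<noteq> 0"
  proof
    assume "emeasure std_normal_distribution {..z} = 0"
    then have "AE x in lborel. ennreal (std_normal_density x) * indicator {..z} x = 0"
      by (subst (asm) emeasure_density) (auto simp: nn_integral_0_iff_AE)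
    moreover have "std_normal_density x > 0" for x
      by (simp add: normal_density_pos)
    then have "std_normal_density x \<noteq> 0" for x
      by (metis less_irrefl)
    ultimately have "AE x in lborel. x \<notin> {..z}"
      by (auto simp: indicator_def elim!: eventually_mono split: if_splits)
    then have "emeasure lborel {..z} = 0"
      by (subst (asm) AE_iff_measurable[OF _ refl]) (auto simp: atMost_def)
    moreover have "emeasure lborel {z - 1..z} \<le> emeasure lborel {..z}"
      by (intro emeasure_mono) auto
    ultimately show False by simp
  qed
  then show ?thesis
    by (simp add: cdf_def2 std_normal.emeasure_eq_measure zero_less_measure_iff)
qed

lemma std_normal_cdf_minus:
  "cdf std_normal_distribution (- z) = 1 - cdf std_normal_distribution z"
proof -
  have "emeasure std_normal_distribution {..-z} =
      (\<integral>\<^sup>+x. ennreal (std_normal_density x) * indicator {..-z} x \<partial>lborel)"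
    by (simp add: emeasure_density)
  also have "\<dots> = (\<integral>\<^sup>+x. ennreal (std_normal_density x) * indicator {z..} x \<partial>lborel)"
    by (subst nn_integral_real_affine[where c="-1" and t=0])
       (auto intro!: nn_integral_cong simp: normal_density_def split: split_indicator)
  also have "\<dots> = emeasure std_normal_distribution {z..}"
    by (simp add: emeasure_density)
  finally have "measure std_normal_distribution {..-z} = measure std_normal_distribution {z..}"
    by (simp add: measure_def)
  moreover have "measure std_normal_distribution {z..} =
      1 - measure std_normal_distribution {..<z}"
    using std_normal.prob_compl[of "{..<z}"] by (simp add: Compl_eq_Diff_UNIV[symmetric])
  moreover have "measure std_normal_distribution {..<z} = cdf std_normal_distribution z"
    using std_normal.cdf_at_left[of z] isCont_std_normal_cdf[of z]
    by (intro tendsto_unique[OF trivial_limit_at_left_real, of "cdf std_normal_distribution" _ z])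
       (auto simp: isCont_def filterlim_at_split)
  ultimately show ?thesis by (simp add: cdf_def2)
qed

lemma std_normal_cdf_less_1: "cdf std_normal_distribution z < 1"
  using std_normal_cdf_pos[of "- z"] by (simp add: std_normal_cdf_minus)

text \<open>For \<open>t \<le> z \<le> 0\<close> the product \<open>z * (t - z)\<close> is nonnegative, so
  \<open>t\<^sup>2 \<ge> z\<^sup>2 + (t - z)\<^sup>2\<close>; the density at \<open>t\<close> is thus at most \<open>exp (- z\<^sup>2 / 2)\<close> times a
  normal density with mean \<open>z\<close>.\<close>

lemma std_normal_cdf_tail:
  assumes "z \<le> 0"
  shows "cdf std_normal_distribution z \<le> exp (- z\<^sup>2 / 2)"
proof -
  have pt: "std_normal_density t \<le> exp (- z\<^sup>2 / 2) * normal_density z 1 t" if "t \<le> z" for t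
  proof -
    have "0 \<le> z * (t - z)"
      using assms that by (simp add: mult_nonpos_nonpos)
    then have "exp (- t\<^sup>2 / 2) \<le> exp (- z\<^sup>2 / 2 + - (t - z)\<^sup>2 / 2)"
      by (simp add: power2_eq_square field_simps)
    then show ?thesis
      by (simp add: normal_density_def exp_add[symmetric] divide_right_mono)
  qed
  have "emeasure std_normal_distribution {..z} =
      (\<integral>\<^sup>+t. ennreal (std_normal_density t) * indicator {..z} t \<partial>lborel)"
    by (simp add: emeasure_density)
  also have "\<dots> \<le> (\<integral>\<^sup>+t. ennreal (exp (- z\<^sup>2 / 2)) * ennreal (normal_density z 1 t) \<partial>lborel)"
    using pt by (intro nn_integral_mono)
      (auto simp: ennreal_mult[symmetric] normal_density_nonneg split: split_indicator)
  also have "\<dots> = ennreal (exp (- z\<^sup>2 / 2))"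
    by (subst nn_integral_cmult)
       (auto simp: nn_integral_eq_integral integrable_normal_density normal_density_nonneg
          integral_normal_density)
  finally show ?thesis
    by (simp add: cdf_def2 std_normal.emeasure_eq_measure)
qed

text \<open>Read through the logarithm, the two tail bounds control the second moment by the very
  quantities whose expectations appear in the entropy.\<close>

lemma square_le_ln_std_normal_cdf:
  "z\<^sup>2 \<le> - 2 * ln (cdf std_normal_distribution z) - 2 * ln (1 - cdf std_normal_distribution z)"
proof -
  have half: "z\<^sup>2 \<le> - 2 * ln (cdf std_normal_distribution z)" if "z \<le> 0" for z
  proof -
    have "ln (cdf std_normal_distribution z) \<le> ln (exp (- z\<^sup>2 / 2))"
      using std_normal_cdf_tail[OF that] std_normal_cdf_pos by (subst ln_le_cancel_iff) auto
    then show ?thesis by simp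
  qed
  have neg: "ln (cdf std_normal_distribution z) \<le> 0" "ln (1 - cdf std_normal_distribution z) \<le> 0"
    using std_normal_cdf_pos[of z] std_normal_cdf_less_1[of z] by simp_all
  show ?thesis
  proof (cases "z \<le> 0")
    case True
    then show ?thesis using half[of z] neg by simp
  next
    case False
    then show ?thesis using half[of "- z"] neg by (simp add: std_normal_cdf_minus)
  qed
qed

section \<open>Logarithmic moments of the beta weight\<close>

definition beta_weight :: "real \<Rightarrow> real \<Rightarrow> real \<Rightarrow> real" where
  "beta_weight a b u = indicator {0..1} u * (u powr (a - 1) * (1 - u) powr (b - 1))"

lemma borel_measurable_beta_weight [measurable]: "beta_weight a b \<in> borel_measurable borel"
  unfolding beta_weight_def by measurable

lemma beta_weight_nonneg: "0 \<le> beta_weight a b u"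
  by (simp add: beta_weight_def)

lemma beta_weight_reflect: "beta_weight a b (1 - u) = beta_weight b a u"
  by (auto simp: beta_weight_def indicator_def)

lemma Beta_real_pos:
  assumes "a > 0" "b > (0::real)"
  shows "0 < Beta a b"
  using assms by (simp add: Beta_def Gamma_real_pos)

lemma has_bochner_integral_beta_weight:
  assumes "a > 0" "b > 0"
  shows "has_bochner_integral lborel (beta_weight a b) (Beta a b)"
proof (rule has_bochner_integral_nn_integral)
  show "(\<integral>\<^sup>+u. ennreal (beta_weight a b u) \<partial>lborel) = ennreal (Beta a b)"
    unfolding beta_weight_def
    by (rule nn_integral_has_integral_lebesgue[OF _ has_integral_Beta_real]) (auto simp: assms)
qed (auto simp: beta_weight_nonneg Beta_real_pos assms less_imp_le)

text \<open>The logarithmic singularity at \<open>0\<close> is absorbed by half of the exponent: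
  \<open>- ln u \<le> (2 / a) * u powr (- a / 2)\<close>.\<close>

lemma integrable_beta_weight_ln:
  assumes "a > 0" "b > 0"
  shows "integrable lborel (\<lambda>u. beta_weight a b u * ln u)"
proof (rule Bochner_Integration.integrable_bound)
  show "integrable lborel (\<lambda>u. 2 / a * beta_weight (a / 2) b u)"
    using has_bochner_integral_beta_weight[of "a / 2" b] assms
    by (intro integrable_mult_right) (auto simp: has_bochner_integral_iff)
  show "AE u in lborel. norm (beta_weight a b u * ln u) \<le> norm (2 / a * beta_weight (a / 2) b u)"
  proof (intro AE_I2)
    fix u :: real
    show "norm (beta_weight a b u * ln u) \<le> norm (2 / a * beta_weight (a / 2) b u)"
    proof (cases "0 < u \<and> u \<le> 1")
      case True
      then have "ln (1 / u) \<le> (1 / u) powr (a / 2) / (a / 2)"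
        using assms by (intro ln_powr_bound) auto
      then have "\<bar>ln u\<bar> \<le> 2 / a * u powr (- (a / 2))"
        using True by (simp add: ln_div powr_minus powr_divide field_simps)
      then have "u powr (a - 1) * \<bar>ln u\<bar> \<le> u powr (a - 1) * (2 / a * u powr (- (a / 2)))"
        by (intro mult_left_mono) auto
      also have "\<dots> = 2 / a * u powr (a / 2 - 1)"
        by (simp add: powr_add[symmetric] field_simps)
      finally have "(1 - u) powr (b - 1) * (u powr (a - 1) * \<bar>ln u\<bar>) \<le>
          (1 - u) powr (b - 1) * (2 / a * u powr (a / 2 - 1))"
        by (intro mult_left_mono) auto
      then show ?thesis
        using True assms by (simp add: beta_weight_def abs_mult mult_ac)
    next
      case False
      then show ?thesis by (auto simp: beta_weight_def indicator_def)
    qed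
  qed
qed measurable

text \<open>Expanding \<open>- ln u = (\<Sum>n. (1 - u) ^ Suc n / Suc n)\<close> turns the integrand into a series of
  nonnegative multiples of beta weights with increasing second parameter, so
  monotone convergence gives convergence of the series of beta values together with its sum.\<close>

lemma beta_weight_ln_sums:
  assumes "a > 0" "b > 0"
  shows "(\<lambda>n. 1 / real (Suc n) * Beta a (real (Suc n) + b)) sums
           - (LINT u|lborel. beta_weight a b u * ln u)"
proof -
  define t where "t n u = 1 / real (Suc n) * beta_weight a (real (Suc n) + b) u" for n u
  have t_nonneg: "0 \<le> t n u" for n u
    by (simp add: t_def beta_weight_nonneg)
  have expand: "(\<lambda>n. t n u) sums (- (beta_weight a b u * ln u))" for u
  proof (cases "0 < u \<and> u < 1")
    case True
    then have "(\<lambda>n. - ((1 - u) ^ n) / real n) sums ln u"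
      using ln_series'[of "u - 1"] by simp
    then have "(\<lambda>n. - ((1 - u) ^ Suc n) / real (Suc n)) sums ln u"
      by (subst sums_Suc_iff) simp
    then have "(\<lambda>n. - beta_weight a b u * (- ((1 - u) ^ Suc n) / real (Suc n))) sums
        (- beta_weight a b u * ln u)"
      by (rule sums_mult)
    moreover have "- beta_weight a b u * (- ((1 - u) ^ Suc n) / real (Suc n)) = t n u" for n
    proof -
      have "(1 - u) powr (real (Suc n) + b - 1) = (1 - u) ^ Suc n * (1 - u) powr (b - 1)"
        using True by (simp add: powr_realpow[symmetric] powr_add[symmetric] algebra_simps
            del: power_Suc)
      then show ?thesis
        by (simp add: t_def beta_weight_def del: power_Suc of_nat_Suc)
    qed
    ultimately show ?thesis by simp
  next
    case False
    \<comment> \<open>The weight itself is \<open>0\<close> here, at the two end points because \<open>0 powr x = 0\<close>.\<close>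
    then have "t n u = 0" for n
      by (cases "u = 0 \<or> u = 1") (auto simp: t_def beta_weight_def indicator_def)
    moreover have "beta_weight a b u * ln u = 0"
      using False by (cases "u = 0 \<or> u = 1") (auto simp: beta_weight_def indicator_def)
    then have "- (beta_weight a b u * ln u) = 0"
      by (subst neg_equal_0_iff_equal)
    ultimately show ?thesis by (simp only: sums_zero)
  qed
  have int: "integrable lborel (\<lambda>u. - (beta_weight a b u * ln u))"
    using integrable_beta_weight_ln[OF assms] by simp
  have nonneg: "0 \<le> - (beta_weight a b u * ln u)" for u
    by (rule sums_le[OF t_nonneg sums_zero expand])
  have "ennreal (- (LINT u|lborel. beta_weight a b u * ln u)) =
      (\<integral>\<^sup>+u. ennreal (- (beta_weight a b u * ln u)) \<partial>lborel)"
    using nn_integral_eq_integral[OF int] nonneg by simp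
  also have "\<dots> = (\<integral>\<^sup>+u. (\<Sum>n. ennreal (t n u)) \<partial>lborel)"
    by (intro nn_integral_cong suminf_ennreal_eq[symmetric] t_nonneg expand)
  also have "\<dots> = (\<Sum>n. \<integral>\<^sup>+u. ennreal (t n u) \<partial>lborel)"
    by (intro nn_integral_suminf) (simp add: t_def)
  also have "\<dots> = (\<Sum>n. ennreal (1 / real (Suc n) * Beta a (real (Suc n) + b)))"
  proof (intro suminf_cong)
    fix n
    have "has_bochner_integral lborel (t n) (1 / real (Suc n) * Beta a (real (Suc n) + b))"
      unfolding t_def using assms
      by (intro has_bochner_integral_mult_right has_bochner_integral_beta_weight) auto
    then show "(\<integral>\<^sup>+u. ennreal (t n u) \<partial>lborel) =
        ennreal (1 / real (Suc n) * Beta a (real (Suc n) + b))"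
      using t_nonneg by (simp add: has_bochner_integral_iff nn_integral_eq_integral)
  qed
  finally have sum: "(\<lambda>n. ennreal (1 / real (Suc n) * Beta a (real (Suc n) + b))) sums
      ennreal (- (LINT u|lborel. beta_weight a b u * ln u))"
    by (simp only: summable_sums[OF summableI])
  have "0 \<le> - (LINT u|lborel. beta_weight a b u * ln u)"
    using Bochner_Integration.integral_nonneg[OF nonneg, of lborel] by simp
  moreover have "0 \<le> 1 / real (Suc n) * Beta a (real (Suc n) + b)" for n
    using Beta_real_pos[of a "real (Suc n) + b"] assms by simp
  ultimately show ?thesis
    using sum by (subst (asm) sums_ennreal)
qed

lemma has_bochner_integral_beta_weight_ln:
  assumes "a > 0" "b > 0"
  shows "has_bochner_integral lborel (\<lambda>u. beta_weight a b u * ln u)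
           (- (\<Sum>n. 1 / real (Suc n) * Beta a (real (Suc n) + b)))"
  using integrable_beta_weight_ln[OF assms] sums_unique[OF beta_weight_ln_sums[OF assms]]
  by (simp add: has_bochner_integral_iff)

lemma has_bochner_integral_beta_weight_ln_reflect:
  assumes "a > 0" "b > 0"
  shows "has_bochner_integral lborel (\<lambda>u. beta_weight a b u * ln (1 - u))
           (- (\<Sum>n. 1 / real (Suc n) * Beta (real (Suc n) + a) b))"
  using has_bochner_integral_beta_weight_ln[OF assms(2,1)]
  by (subst (asm) lborel_has_bochner_integral_real_affine_iff[where c="-1" and t=1])
     (simp_all add: beta_weight_reflect Beta_commute[of b])

section \<open>The entropy of the beta normal law\<close>

lemma has_bochner_integral_std_normal_cdf:
  fixes h :: "real \<Rightarrow> real"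
  assumes h: "has_bochner_integral lborel h I"
    and outside: "\<And>u. u \<notin> {0..1} \<Longrightarrow> h u = 0"
  shows "has_bochner_integral lborel
           (\<lambda>z. std_normal_density z * h (cdf std_normal_distribution z)) I"
proof -
  have [measurable]: "h \<in> borel_measurable borel"
    using h by (auto simp: has_bochner_integral_iff dest: borel_measurable_integrable)
  have uniform: "uniform_measure lborel {0..1::real} =
      density lborel (\<lambda>u. ennreal (indicator {0..1} u))"
    unfolding uniform_measure_def by (simp add: ennreal_indicator divide_ennreal_def)
  have ind: "indicator {0..1} u * h u = h u" for u
    using outside[of u] by (cases "u \<in> {0..1}") auto
  have "has_bochner_integral (uniform_measure lborel {0..1}) h I"
    unfolding uniform using h
    by (intro has_bochner_integral_density) (simp_all add: ind)
  then have "has_bochner_integral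
      (distr std_normal_distribution borel (cdf std_normal_distribution)) h I"
    by (simp add: std_normal.distr_cdf_uniform isCont_std_normal_cdf)
  then have "has_bochner_integral std_normal_distribution
      (\<lambda>z. h (cdf std_normal_distribution z)) I"
    by (simp add: has_bochner_integral_iff integrable_distr_eq integral_distr)
  then show ?thesis
    by (simp add: has_bochner_integral_iff integrable_real_density integral_real_density
        normal_density_nonneg)
qed

lemma beta_normal_density_nonneg:
  assumes "\<alpha> > 0" "\<beta> > 0" "\<sigma> > 0"
  shows "0 \<le> beta_normal_density \<alpha> \<beta> \<mu> \<sigma> x"
  using assms Beta_real_pos[of \<alpha> \<beta>]
  by (simp add: beta_normal_density_def normal_density_nonneg)

lemma borel_measurable_beta_normal_density [measurable]:
  "beta_normal_density \<alpha> \<beta> \<mu> \<sigma> \<in> borel_measurable borel"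
  unfolding beta_normal_density_def by measurable

text \<open>Integrals against the beta normal density of functions of \<open>\<Phi> ((x - \<mu>) / \<sigma>)\<close> are
  integrals against the beta density, since \<open>\<Phi>\<close> maps the standard normal law to the uniform one.\<close>

lemma has_bochner_integral_beta_normal:
  assumes pos: "\<alpha> > 0" "\<beta> > 0" "\<sigma> > 0"
    and g: "has_bochner_integral lborel (\<lambda>u. beta_weight \<alpha> \<beta> u * g u) I"
  shows "has_bochner_integral lborel
           (\<lambda>x. beta_normal_density \<alpha> \<beta> \<mu> \<sigma> x * g (cdf std_normal_distribution ((x - \<mu>) / \<sigma>)))
           (I / Beta \<alpha> \<beta>)"
proof -
  let ?\<Phi> = "cdf std_normal_distribution"
  let ?k = "\<lambda>z. std_normal_density z * (beta_weight \<alpha> \<beta> (?\<Phi> z) * g (?\<Phi> z))"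
  have "has_bochner_integral lborel ?k I"
    using g by (rule has_bochner_integral_std_normal_cdf) (simp add: beta_weight_def)
  then have "has_bochner_integral lborel (\<lambda>x. ?k (- \<mu> / \<sigma> + (1 / \<sigma>) * x)) (I /\<^sub>R \<bar>1 / \<sigma>\<bar>)"
    using pos by (subst (asm) lborel_has_bochner_integral_real_affine_iff[where c="1 / \<sigma>"
          and t="- \<mu> / \<sigma>"]) auto
  then have "has_bochner_integral lborel (\<lambda>x. ?k ((x - \<mu>) / \<sigma>)) (\<sigma> * I)"
    using pos by (simp add: diff_divide_distrib)
  then have "has_bochner_integral lborel
      (\<lambda>x. 1 / (\<sigma> * Beta \<alpha> \<beta>) * ?k ((x - \<mu>) / \<sigma>)) (1 / (\<sigma> * Beta \<alpha> \<beta>) * (\<sigma> * I))"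
    by (rule has_bochner_integral_mult_right)
  moreover have "1 / (\<sigma> * Beta \<alpha> \<beta>) * ?k ((x - \<mu>) / \<sigma>) =
      beta_normal_density \<alpha> \<beta> \<mu> \<sigma> x * g (?\<Phi> ((x - \<mu>) / \<sigma>))" for x
    using std_normal_cdf_pos[of "(x - \<mu>) / \<sigma>"] std_normal_cdf_less_1[of "(x - \<mu>) / \<sigma>"]
    by (simp add: beta_normal_density_def beta_weight_def)
  ultimately show ?thesis
    using pos by simp
qed

lemma ln_beta_normal_density:
  assumes pos: "\<alpha> > 0" "\<beta> > 0" "\<sigma> > 0"
  shows "ln (beta_normal_density \<alpha> \<beta> \<mu> \<sigma> x) =
    (\<alpha> - 1) * ln (cdf std_normal_distribution ((x - \<mu>) / \<sigma>))
    + (\<beta> - 1) * ln (1 - cdf std_normal_distribution ((x - \<mu>) / \<sigma>))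
    - ((x - \<mu>) / \<sigma>)\<^sup>2 / 2 - ln (sqrt (2 * pi) * \<sigma> * Beta \<alpha> \<beta>)"
proof -
  define z where "z = (x - \<mu>) / \<sigma>"
  note \<Phi> = std_normal_cdf_pos[of z] std_normal_cdf_less_1[of z]
  have B: "0 < Beta \<alpha> \<beta>"
    using pos by (simp add: Beta_real_pos)
  have "beta_normal_density \<alpha> \<beta> \<mu> \<sigma> x =
      cdf std_normal_distribution z powr (\<alpha> - 1) * (1 - cdf std_normal_distribution z) powr (\<beta> - 1)
      * exp (- z\<^sup>2 / 2) / (sqrt (2 * pi) * \<sigma> * Beta \<alpha> \<beta>)"
    by (simp add: beta_normal_density_def std_normal_density_def z_def)
  then show ?thesis
    using \<Phi> B pos unfolding z_def[symmetric]
    by (simp add: ln_div ln_mult ln_powr)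
qed

text \<open>The dominating function is the one from \<open>square_le_ln_std_normal_cdf\<close>; its integrability
  is that of the logarithms against the beta weight.\<close>

lemma integrable_beta_normal_square:
  assumes pos: "\<alpha> > 0" "\<beta> > 0" "\<sigma> > 0"
  shows "integrable lborel (\<lambda>x. beta_normal_density \<alpha> \<beta> \<mu> \<sigma> x * ((x - \<mu>) / \<sigma>)\<^sup>2)"
proof (rule Bochner_Integration.integrable_bound)
  let ?f = "beta_normal_density \<alpha> \<beta> \<mu> \<sigma>"
  let ?\<Phi> = "\<lambda>x. cdf std_normal_distribution ((x - \<mu>) / \<sigma>)"
  show "integrable lborel (\<lambda>x. - 2 * (?f x * ln (?\<Phi> x)) - 2 * (?f x * ln (1 - ?\<Phi> x)))"
    using has_bochner_integral_beta_normal[OF pos has_bochner_integral_beta_weight_ln[OF pos(1,2)]]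
      has_bochner_integral_beta_normal[OF pos
        has_bochner_integral_beta_weight_ln_reflect[OF pos(1,2)]]
    by (intro Bochner_Integration.integrable_diff integrable_mult_right)
       (auto simp: has_bochner_integral_iff)
  show "AE x in lborel. norm (?f x * ((x - \<mu>) / \<sigma>)\<^sup>2) \<le>
      norm (- 2 * (?f x * ln (?\<Phi> x)) - 2 * (?f x * ln (1 - ?\<Phi> x)))"
  proof (intro AE_I2)
    fix x
    have "?f x * ((x - \<mu>) / \<sigma>)\<^sup>2 \<le> ?f x * (- 2 * ln (?\<Phi> x) - 2 * ln (1 - ?\<Phi> x))"
      using beta_normal_density_nonneg[OF pos] by (intro mult_left_mono square_le_ln_std_normal_cdf)
    also have "\<dots> = - 2 * (?f x * ln (?\<Phi> x)) - 2 * (?f x * ln (1 - ?\<Phi> x))"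
      by (simp add: algebra_simps)
    finally show "norm (?f x * ((x - \<mu>) / \<sigma>)\<^sup>2) \<le>
        norm (- 2 * (?f x * ln (?\<Phi> x)) - 2 * (?f x * ln (1 - ?\<Phi> x)))"
      using beta_normal_density_nonneg[OF pos, of \<mu> x] by (simp add: abs_mult del: times_divide_eq_right)
  qed
qed measurable

theorem mainTheorem8:
  fixes M :: "'a measure" and X :: "'a \<Rightarrow> real" and \<alpha> \<beta> \<mu> \<sigma> :: real
  assumes "\<alpha> > 0" and "\<beta> > 0" and "\<sigma> > 0"
    and "prob_space M"
    and "distributed M lborel X (\<lambda>x. ennreal (beta_normal_density \<alpha> \<beta> \<mu> \<sigma> x))"
  shows "integrable lborel
           (\<lambda>x. beta_normal_density \<alpha> \<beta> \<mu> \<sigma> x * ln (beta_normal_density \<alpha> \<beta> \<mu> \<sigma> x))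
       \<and> integrable M X
       \<and> integrable M (\<lambda>\<omega>. (X \<omega>)\<^sup>2)
       \<and> summable (\<lambda>n. 1 / real (Suc n) *
           ((\<alpha> - 1) * Beta \<alpha> (real (Suc n) + \<beta>) + (\<beta> - 1) * Beta (real (Suc n) + \<alpha>) \<beta>))
       \<and> shannon_entropy (beta_normal_density \<alpha> \<beta> \<mu> \<sigma>) =
           ln (sqrt (2 * pi) * \<sigma> * Beta \<alpha> \<beta>)
         + 1 / (2 * \<sigma>\<^sup>2) *
             (prob_space.expectation M (\<lambda>\<omega>. (X \<omega>)\<^sup>2) - 2 * \<mu> * prob_space.expectation M X + \<mu>\<^sup>2)
         + 1 / Beta \<alpha> \<beta> *
             (\<Sum>n. 1 / real (Suc n) *
               ((\<alpha> - 1) * Beta \<alpha> (real (Suc n) + \<beta>) + (\<beta> - 1) * Beta (real (Suc n) + \<alpha>) \<beta>))"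
proof -
  interpret prob_space M by fact
  note pos = assms(1-3)
  note X = assms(5)
  let ?f = "beta_normal_density \<alpha> \<beta> \<mu> \<sigma>"
  let ?\<Phi> = "\<lambda>x. cdf std_normal_distribution ((x - \<mu>) / \<sigma>)"
  let ?L = "ln (sqrt (2 * pi) * \<sigma> * Beta \<alpha> \<beta>)"
  let ?z = "\<lambda>x. (x - \<mu>) / \<sigma>"
  let ?a = "\<lambda>n. 1 / real (Suc n) * Beta \<alpha> (real (Suc n) + \<beta>)"
  let ?b = "\<lambda>n. 1 / real (Suc n) * Beta (real (Suc n) + \<alpha>) \<beta>"
  have f_nonneg: "0 \<le> ?f x" for x
    using pos by (rule beta_normal_density_nonneg)
  have B: "0 < Beta \<alpha> \<beta>"
    using pos by (simp add: Beta_real_pos)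

  \<comment> \<open>Both moments of \<open>X\<close> are read off from those of the standardized variable.\<close>
  have zsq_f: "integrable lborel (\<lambda>x. ?f x * (?z x)\<^sup>2)"
    using pos by (rule integrable_beta_normal_square)
  have zsq: "integrable M (\<lambda>\<omega>. (?z (X \<omega>))\<^sup>2)"
    using zsq_f f_nonneg by (subst (asm) distributed_integrable[OF X]) auto
  have [measurable]: "X \<in> borel_measurable M"
    using distributed_measurable[OF X] by simp
  have z: "integrable M (\<lambda>\<omega>. ?z (X \<omega>))"
    by (rule square_integrable_imp_integrable[OF _ zsq]) simp
  have "integrable M (\<lambda>\<omega>. \<mu> + \<sigma> * ?z (X \<omega>))"
    by (intro Bochner_Integration.integrable_add integrable_mult_right integrable_const z)
  then have intX: "integrable M X"
    using pos by simp
  have "integrable M (\<lambda>\<omega>. \<sigma>\<^sup>2 * (?z (X \<omega>))\<^sup>2 + 2 * \<mu> * X \<omega> - \<mu>\<^sup>2)"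
    by (intro Bochner_Integration.integrable_add Bochner_Integration.integrable_diff
        integrable_mult_right integrable_const zsq intX)
  moreover have "\<sigma>\<^sup>2 * (?z x)\<^sup>2 + 2 * \<mu> * x - \<mu>\<^sup>2 = x\<^sup>2" for x
    using pos by (simp add: power_divide power2_diff)
  ultimately have intX2: "integrable M (\<lambda>\<omega>. (X \<omega>)\<^sup>2)"
    by simp
  have "(LINT x|lborel. ?f x * (?z x)\<^sup>2) = expectation (\<lambda>\<omega>. (?z (X \<omega>))\<^sup>2)"
    using f_nonneg by (intro distributed_integral[OF X]) auto
  also have "\<dots> = expectation (\<lambda>\<omega>. ((X \<omega>)\<^sup>2 - 2 * \<mu> * X \<omega> + \<mu>\<^sup>2) / \<sigma>\<^sup>2)"
    by (intro Bochner_Integration.integral_cong refl)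
       (simp only: power_divide power2_diff diff_add_eq mult.commute mult.left_commute)
  also have "\<dots> = (expectation (\<lambda>\<omega>. (X \<omega>)\<^sup>2) - 2 * \<mu> * expectation X + \<mu>\<^sup>2) / \<sigma>\<^sup>2"
    using intX intX2 by (simp add: prob_space)
  finally have Ez: "(LINT x|lborel. ?f x * (?z x)\<^sup>2) =
      (expectation (\<lambda>\<omega>. (X \<omega>)\<^sup>2) - 2 * \<mu> * expectation X + \<mu>\<^sup>2) / \<sigma>\<^sup>2" .

  have one: "has_bochner_integral lborel ?f 1"
    using has_bochner_integral_beta_normal[OF pos, of "\<lambda>_. 1" "Beta \<alpha> \<beta>" \<mu>]
      has_bochner_integral_beta_weight[OF pos(1,2)] B by simp
  have ln_\<Phi>: "has_bochner_integral lborel (\<lambda>x. ?f x * ln (?\<Phi> x)) (- suminf ?a / Beta \<alpha> \<beta>)"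
    using pos by (intro has_bochner_integral_beta_normal has_bochner_integral_beta_weight_ln)
  have ln_1_\<Phi>: "has_bochner_integral lborel (\<lambda>x. ?f x * ln (1 - ?\<Phi> x)) (- suminf ?b / Beta \<alpha> \<beta>)"
    using pos
    by (intro has_bochner_integral_beta_normal[where g = "\<lambda>u. ln (1 - u)"]
        has_bochner_integral_beta_weight_ln_reflect)
  have "has_bochner_integral lborel
      (\<lambda>x. (\<alpha> - 1) * (?f x * ln (?\<Phi> x)) + (\<beta> - 1) * (?f x * ln (1 - ?\<Phi> x))
           - 1 / 2 * (?f x * (?z x)\<^sup>2) - ?L * ?f x)
      ((\<alpha> - 1) * (- suminf ?a / Beta \<alpha> \<beta>) + (\<beta> - 1) * (- suminf ?b / Beta \<alpha> \<beta>)
           - 1 / 2 * (LINT x|lborel. ?f x * (?z x)\<^sup>2) - ?L * 1)"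
    using zsq_f
    by (intro has_bochner_integral_add has_bochner_integral_diff has_bochner_integral_mult_right
        one ln_\<Phi> ln_1_\<Phi> has_bochner_integral_integrable)
  moreover have "(\<alpha> - 1) * (?f x * ln (?\<Phi> x)) + (\<beta> - 1) * (?f x * ln (1 - ?\<Phi> x))
      - 1 / 2 * (?f x * (?z x)\<^sup>2) - ?L * ?f x = ?f x * ln (?f x)" for x
    unfolding ln_beta_normal_density[OF pos] by (simp add: algebra_simps)
  ultimately have main: "has_bochner_integral lborel (\<lambda>x. ?f x * ln (?f x))
      ((\<alpha> - 1) * (- suminf ?a / Beta \<alpha> \<beta>) + (\<beta> - 1) * (- suminf ?b / Beta \<alpha> \<beta>)
           - 1 / 2 * (LINT x|lborel. ?f x * (?z x)\<^sup>2) - ?L * 1)"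
    by (simp only:)

  have "summable ?a"
    using beta_weight_ln_sums[OF pos(1,2)] by (rule sums_summable)
  moreover have "summable ?b"
    using beta_weight_ln_sums[OF pos(2,1)]
    by (simp only: Beta_commute[of \<beta>] sums_summable)
  ultimately have "(\<lambda>n. (\<alpha> - 1) * ?a n + (\<beta> - 1) * ?b n) sums
      ((\<alpha> - 1) * suminf ?a + (\<beta> - 1) * suminf ?b)"
    by (intro sums_add sums_mult summable_sums)
  then have series: "(\<lambda>n. 1 / real (Suc n) *
      ((\<alpha> - 1) * Beta \<alpha> (real (Suc n) + \<beta>) + (\<beta> - 1) * Beta (real (Suc n) + \<alpha>) \<beta>)) sums
      ((\<alpha> - 1) * suminf ?a + (\<beta> - 1) * suminf ?b)"
    by (simp only: distrib_left mult.left_commute[of "1 / real (Suc _)"])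

  have regroup: "- (a * (- S / C) + b * (- T / C) - 1 / 2 * (V / r) - L * 1) =
      L + 1 / (2 * r) * V + 1 / C * (a * S + b * T)" for a b C L S T V r :: real
    by (simp add: add_divide_distrib)
  have entropy: "shannon_entropy ?f = ?L
      + 1 / (2 * \<sigma>\<^sup>2) * (expectation (\<lambda>\<omega>. (X \<omega>)\<^sup>2) - 2 * \<mu> * expectation X + \<mu>\<^sup>2)
      + 1 / Beta \<alpha> \<beta> * ((\<alpha> - 1) * suminf ?a + (\<beta> - 1) * suminf ?b)"
    unfolding shannon_entropy_def has_bochner_integral_integral_eq[OF main] Ez
    by (rule regroup)
  show ?thesis
    using main intX intX2 sums_summable[OF series] entropy sums_unique[OF series]
    by (simp only: has_bochner_integral_iff simp_thms)
qed

end
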